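(* For integers $x,y,z,t$ define the points of $\mathbb Z^3$ $$\begin{aligned} P(x,y,z,t)=\big[\,&x^2+y^2-z^2-t^2+2(xt-yz),\ -x^2+y^2-z^2+t^2+2(yz+xt),\ 2(yt-zt-xy-xz)\,\big],\\ Q(x,y,z,t)=\big[\,&x^2+y^2-z^2-t^2+2(yt+xz),\ 2(yz+zt+xt-xy),\ x^2-y^2-z^2+t^2+2(yt-xz)\,\big]. \end{aligned}$$ Let $O$ be the origin. (1) Every minimal equilateral triangle in $\mathbb Z^3$ having the origin as one of its vertices is, up to a basic rotation, the triangle with vertices $O$, $P(x,y,z,t)$, $Q(x,y,z,t)$ for some $x,y,z,t\in\mathbb Z$. (2) Conversely, for every $x,y,z,t\in\mathbb Z$, the points $P(x,y,z,t)$ and $Q(x,y,z,t)$ together with the origin form an equilateral triangle in $\mathbb Z^3$ whose side lengths are all equal to $L=(x^2+y^2+z^2+t^2)\sqrt2$.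
   Context: An equilateral triangle in $\mathbb Z^3$ is one whose three vertices have integer coordinates; triangles are regarded as unordered sets of vertices, and in (2) the case $x=y=z=t=0$ is understood as the degenerate triangle of side length $0$. Minimal triangles: if a (nondegenerate) equilateral triangle in $\mathbb Z^3$ has the origin $O$ as a vertex, its plane is orthogonal to an integer vector $(A,B,C)$ with $\gcd(A,B,C)=1$, and one has $A^2+B^2+C^2=3D^2$ for some positive integer $D$. The triangle is called minimal if its side length is $D\sqrt2$. (All equilateral triangles $OP'Q'$ with integer coordinates in that plane are obtained from one minimal triangle $OPQ$, with $\vec\zeta=\overrightarrow{OP}$ and $\vec\eta=\overrightarrow{OQ}$, by $\overrightarrow{OP'}=m\vec\zeta-n\vec\eta$, $\overrightarrow{OQ'}=n\vec\zeta+(m-n)\vec\eta$ with $m,n\in\mathbb Z$, and have side length $D\sqrt{2(m^2-mn+n^2)}$.) Basic rotations: a basic rotation of a triangle $OPQ$ with $\vec\zeta=\overrightarrow{OP}$, $\vec\eta=\overrightarrow{OQ}$ replaces it by the triangle $OP'Q'$ with $\overrightarrow{OP'}=m\vec\zeta-n\vec\eta$, $\overrightarrow{OQ'}=n\vec\zeta+(m-n)\vec\eta$, where $(m,n)\in\{(1,0),(1,1),(0,1),(-1,0),(-1,-1),(0,-1)\}$. *)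

theory Defs
  imports "HOL-Analysis.Analysis"
begin

text \<open>Points of the integer lattice are taken inside \<^typ>\<open>real^3\<close>, so that distances, orthogonality
  and affine hulls are those of Euclidean space.\<close>

definition int_lattice :: "(real^3) set" where
  "int_lattice = {v. \<forall>i. v $ i \<in> \<int>}"

text \<open>A triangle is its unordered set of vertices. Side length 0 is allowed and gives the degenerate
  triangle (a single point); for a positive side length the three vertices are automatically
  distinct.\<close>

definition equilateral_triangle :: "real \<Rightarrow> (real^3) set \<Rightarrow> bool" where
  "equilateral_triangle L T \<longleftrightarrow>
     (\<exists>a b c. T = {a, b, c} \<and> dist a b = L \<and> dist b c = L \<and> dist c a = L)"

text \<open>Minimality, for triangles with a vertex at the origin. The plane of the triangle is its affine
  hull; it passes through the origin, so it is orthogonal to \<open>(A, B, C)\<close> iff all its points are.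
  Since \<open>D > 0\<close>, the triangle is nondegenerate, so \<open>(A, B, C)\<close> is unique up to sign and
  \<open>D\<close> is determined by the triangle.\<close>

definition minimal_triangle :: "(real^3) set \<Rightarrow> bool" where
  "minimal_triangle T \<longleftrightarrow>
     T \<subseteq> int_lattice \<and> 0 \<in> T \<and>
     (\<exists>A B C D :: int.
        gcd A (gcd B C) = 1 \<and>
        (\<forall>v \<in> affine hull T. orthogonal (vector [of_int A, of_int B, of_int C]) v) \<and>
        D > 0 \<and> A\<^sup>2 + B\<^sup>2 + C\<^sup>2 = 3 * D\<^sup>2 \<and>
        equilateral_triangle (of_int D * sqrt 2) T)"

text \<open>\<open>T'\<close> arises from \<open>T\<close> by a basic rotation. The labelling of the two vertices of \<open>T\<close> other than the
  origin is arbitrary; exchanging them permutes the six resulting triangles.\<close>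

definition basic_rotation :: "(real^3) set \<Rightarrow> (real^3) set \<Rightarrow> bool" where
  "basic_rotation T T' \<longleftrightarrow>
     (\<exists>\<zeta> \<eta>. \<exists>(m, n) \<in> {(1, 0), (1, 1), (0, 1), (-1, 0), (-1, -1), (0, -1)} :: (int \<times> int) set.
        T = {0, \<zeta>, \<eta>} \<and>
        T' = {0, of_int m *\<^sub>R \<zeta> - of_int n *\<^sub>R \<eta>, of_int n *\<^sub>R \<zeta> + of_int (m - n) *\<^sub>R \<eta>})"

definition vertex_P :: "int \<Rightarrow> int \<Rightarrow> int \<Rightarrow> int \<Rightarrow> real^3" where
  "vertex_P x y z t = vector
     [of_int (x\<^sup>2 + y\<^sup>2 - z\<^sup>2 - t\<^sup>2 + 2 * (x*t - y*z)),
      of_int (- (x\<^sup>2) + y\<^sup>2 - z\<^sup>2 + t\<^sup>2 + 2 * (y*z + x*t)),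
      of_int (2 * (y*t - z*t - x*y - x*z))]"

definition vertex_Q :: "int \<Rightarrow> int \<Rightarrow> int \<Rightarrow> int \<Rightarrow> real^3" where
  "vertex_Q x y z t = vector
     [of_int (x\<^sup>2 + y\<^sup>2 - z\<^sup>2 - t\<^sup>2 + 2 * (y*t + x*z)),
      of_int (2 * (y*z + z*t + x*t - x*y)),
      of_int (x\<^sup>2 - y\<^sup>2 - z\<^sup>2 + t\<^sup>2 + 2 * (y*t - x*z))]"

end

theory Submission
  imports Defs
begin

text \<open>Read \<open>(x, y, z, t)\<close> as the quaternion \<open>r = x + yi + zj + tk\<close>, with norm \<open>N = x\<^sup>2 + y\<^sup>2 + z\<^sup>2 + t\<^sup>2\<close>, and
  vectors of three-space as pure quaternions. For \<open>r \<noteq> 0\<close> the map \<open>v \<mapsto> r v r\<inverse>\<close> is a rotation, and \<open>v \<mapsto> r v r*\<close>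
  (\<open>r*\<close> the conjugate) is \<open>N\<close> times that rotation, with integer matrix given by the Euler-Rodrigues
  formula. The points \<open>P(x, y, z, t)\<close> and \<open>Q(x, y, z, t)\<close> are the images of \<open>\<zeta>\<^sub>0 = (1, -1, 0)\<close> and
  \<open>\<eta>\<^sub>0 = (1, 0, 1)\<close> under it. These two vectors span an equilateral triangle of side \<open>\<surd>2\<close> with the
  origin, so \<open>P\<close> and \<open>Q\<close> span one of side \<open>N\<surd>2\<close>; this is the converse direction.

  For the direct part let \<open>\<zeta>, \<eta>\<close> be the vertices of a minimal triangle of side \<open>D\<surd>2\<close>. By minimality its
  cross product \<open>\<zeta> \<times> \<eta>\<close> is \<open>D\<nu>\<close> with a primitive integer vector \<open>\<nu>\<close>. There is a unique rotation,
  scaled by \<open>D\<close>, taking \<open>\<zeta>\<^sub>0, \<eta>\<^sub>0\<close> to \<open>\<zeta>, \<eta>\<close>; it takes \<open>n\<^sub>0 = \<zeta>\<^sub>0 \<times> \<eta>\<^sub>0 = (-1, -1, 1)\<close> to \<open>\<nu>\<close>. Since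
  \<open>\<zeta>\<^sub>0, \<eta>\<^sub>0, n\<^sub>0\<close> span a sublattice of index 3 of the integer lattice, three times its matrix is
  integral. A rotation with rational matrix comes from an integer quaternion
  (\<open>rotation_by_integer_quaternion\<close>), which can be taken primitive. Comparing scales gives
  \<open>P(r) = s\<zeta>\<close>, \<open>Q(r) = s\<eta>\<close> and \<open>r n\<^sub>0 r* = s\<nu>\<close> with \<open>s = N/D\<close>. Here \<open>s\<close> is an integer because \<open>\<nu>\<close> is
  primitive, and \<open>s\<close> divides 12 because \<open>r\<close> is primitive (\<open>triangle_multiple_PQ\<close>).

  It remains to remove the factor \<open>s\<close>. Multiplying \<open>r\<close> on the right by a quaternion \<open>u\<close> first moves
  \<open>\<zeta>\<^sub>0, \<eta>\<^sub>0\<close> by \<open>u\<close>. If \<open>u\<close> induces one of the twelve rotations that preserve the hexagon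
  \<open>\<plusminus>\<zeta>\<^sub>0, \<plusminus>\<eta>\<^sub>0, \<plusminus>(\<zeta>\<^sub>0 - \<eta>\<^sub>0)\<close>, the triangle changes only by a basic rotation. The choice \<open>u = n\<^sub>0\<close>
  of norm 3 removes the prime 3 (\<open>remove_factor_three\<close>), a half turn about a side vector, of norm 2,
  removes \<open>s = 2\<close> (\<open>remove_factor_two\<close>), and a third of a turn \<open>1 \<plusminus> n\<^sub>0\<close>, of norm 4, removes \<open>s = 4\<close>
  (\<open>remove_factor_four\<close>) unless \<open>r\<close> itself is even. Congruences on \<open>r\<close> make \<open>ru\<close> divisible by 3, 2
  or 4, respectively.\<close>

section \<open>The parametrised triangles are equilateral\<close>

text \<open>These hold because \<open>\<zeta>\<^sub>0\<close>, \<open>\<eta>\<^sub>0\<close> and \<open>\<zeta>\<^sub>0 - \<eta>\<^sub>0\<close> have squared length 2 and \<open>v \<mapsto> r v r*\<close> multiplies lengths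
  by the norm of \<open>r\<close>.\<close>

lemma vertex_PQ_norms:
  "(norm (vertex_P x y z t))\<^sup>2 = 2 * (of_int (x\<^sup>2+y\<^sup>2+z\<^sup>2+t\<^sup>2))\<^sup>2"
  "(norm (vertex_Q x y z t))\<^sup>2 = 2 * (of_int (x\<^sup>2+y\<^sup>2+z\<^sup>2+t\<^sup>2))\<^sup>2"
  "(norm (vertex_P x y z t - vertex_Q x y z t))\<^sup>2 = 2 * (of_int (x\<^sup>2+y\<^sup>2+z\<^sup>2+t\<^sup>2))\<^sup>2"
  unfolding power2_norm_eq_inner vertex_P_def vertex_Q_def inner_vec_def sum_3
  by (simp_all, algebra+)

lemma vertex_PQ_lattice: "{0, vertex_P x y z t, vertex_Q x y z t} \<subseteq> int_lattice"
  by (auto simp: int_lattice_def forall_3 vertex_P_def vertex_Q_def)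

lemma vertex_PQ_equilateral:
  "equilateral_triangle (of_int (x\<^sup>2 + y\<^sup>2 + z\<^sup>2 + t\<^sup>2) * sqrt 2) {0, vertex_P x y z t, vertex_Q x y z t}"
proof -
  define L :: real where "L = of_int (x\<^sup>2 + y\<^sup>2 + z\<^sup>2 + t\<^sup>2) * sqrt 2"
  have "0 \<le> L" "L\<^sup>2 = 2 * (of_int (x\<^sup>2+y\<^sup>2+z\<^sup>2+t\<^sup>2))\<^sup>2"
    by (simp_all add: L_def power_mult_distrib del: of_int_add)
  then have "norm v = L" if "(norm v)\<^sup>2 = 2 * (of_int (x\<^sup>2+y\<^sup>2+z\<^sup>2+t\<^sup>2))\<^sup>2" for v :: "real^3"
    using that by (metis norm_ge_zero power2_eq_imp_eq)
  from this[OF vertex_PQ_norms(1)] this[OF vertex_PQ_norms(2)] this[OF vertex_PQ_norms(3)]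
  have "dist 0 (vertex_P x y z t) = L" "dist (vertex_P x y z t) (vertex_Q x y z t) = L"
     "dist (vertex_Q x y z t) 0 = L"
    by (simp_all add: dist_norm)
  then show ?thesis
    unfolding L_def equilateral_triangle_def by blast
qed

section \<open>Rotations and integer quaternions\<close>

text \<open>The matrix with columns \<open>a, b, c\<close> is \<open>E\<close> times a rotation. For \<open>E \<noteq> 0\<close> the cross products say
  that the cofactor matrix is \<open>E\<close> times the matrix, which only the zero matrix and scaled rotations
  satisfy, and the length of the first column excludes zero. This form is kept because it is
  visibly preserved when two columns change sign.\<close>

definition scaled_rotation ::
    "int \<Rightarrow> int \<Rightarrow> int \<Rightarrow> int \<Rightarrow> int \<Rightarrow> int \<Rightarrow> int \<Rightarrow> int \<Rightarrow> int \<Rightarrow> int \<Rightarrow> bool" where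
  "scaled_rotation E a1 a2 a3 b1 b2 b3 c1 c2 c3 \<longleftrightarrow>
     a1\<^sup>2 + a2\<^sup>2 + a3\<^sup>2 = E\<^sup>2 \<and>
     a2*b3 - a3*b2 = E*c1 \<and> a3*b1 - a1*b3 = E*c2 \<and> a1*b2 - a2*b1 = E*c3 \<and>
     b2*c3 - b3*c2 = E*a1 \<and> b3*c1 - b1*c3 = E*a2 \<and> b1*c2 - b2*c1 = E*a3 \<and>
     c2*a3 - c3*a2 = E*b1 \<and> c3*a1 - c1*a3 = E*b2 \<and> c1*a2 - c2*a1 = E*b3"

text \<open>Cramer's rule turns the cross product relations into the orthogonality of columns and of rows,
  but only after multiplication by \<open>E\<close>.\<close>

lemma scaled_rotation_orthogonal:
  assumes M: "scaled_rotation E a1 a2 a3 b1 b2 b3 c1 c2 c3" and E: "E \<noteq> 0"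
  shows "a1\<^sup>2 + a2\<^sup>2 + a3\<^sup>2 = E\<^sup>2" "b1\<^sup>2 + b2\<^sup>2 + b3\<^sup>2 = E\<^sup>2" "c1\<^sup>2 + c2\<^sup>2 + c3\<^sup>2 = E\<^sup>2"
    "a1*b1 + a2*b2 + a3*b3 = 0" "a1*c1 + a2*c2 + a3*c3 = 0" "b1*c1 + b2*c2 + b3*c3 = 0"
    "a1\<^sup>2 + b1\<^sup>2 + c1\<^sup>2 = E\<^sup>2" "a2\<^sup>2 + b2\<^sup>2 + c2\<^sup>2 = E\<^sup>2" "a3\<^sup>2 + b3\<^sup>2 + c3\<^sup>2 = E\<^sup>2"
    "a1*a2 + b1*b2 + c1*c2 = 0" "a1*a3 + b1*b3 + c1*c3 = 0" "a2*a3 + b2*b3 + c2*c3 = 0"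
proof -
  have cancel: "p = q" if "E * p = E * q" for p q
    using that E by simp
  note M = M[unfolded scaled_rotation_def]
  show "a1\<^sup>2 + a2\<^sup>2 + a3\<^sup>2 = E\<^sup>2" "b1\<^sup>2 + b2\<^sup>2 + b3\<^sup>2 = E\<^sup>2" "c1\<^sup>2 + c2\<^sup>2 + c3\<^sup>2 = E\<^sup>2"
    "a1*b1 + a2*b2 + a3*b3 = 0" "a1*c1 + a2*c2 + a3*c3 = 0" "b1*c1 + b2*c2 + b3*c3 = 0"
    "a1\<^sup>2 + b1\<^sup>2 + c1\<^sup>2 = E\<^sup>2" "a2\<^sup>2 + b2\<^sup>2 + c2\<^sup>2 = E\<^sup>2" "a3\<^sup>2 + b3\<^sup>2 + c3\<^sup>2 = E\<^sup>2"
    "a1*a2 + b1*b2 + c1*c2 = 0" "a1*a3 + b1*b3 + c1*c3 = 0" "a2*a3 + b2*b3 + c2*c3 = 0"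
    by (rule cancel, insert M, algebra)+
qed

text \<open>With \<open>N\<close> the norm of the quaternion \<open>r = x + yi + zj + tk\<close>, the right-hand sides are \<open>E\<close> times
  the entries of the matrix of \<open>v \<mapsto> r v r*\<close> (the Euler-Rodrigues formula). Clearing
  denominators allows quaternions of any norm.\<close>

definition quaternion_represents ::
    "int \<Rightarrow> int \<Rightarrow> int \<Rightarrow> int \<Rightarrow> int \<Rightarrow> int \<Rightarrow> int \<Rightarrow> int \<Rightarrow> int \<Rightarrow> int \<Rightarrow> int \<Rightarrow> int \<Rightarrow> int \<Rightarrow> int \<Rightarrow> bool"
  where "quaternion_represents x y z t E a1 a2 a3 b1 b2 b3 c1 c2 c3 \<longleftrightarrow>
    (let N = x\<^sup>2 + y\<^sup>2 + z\<^sup>2 + t\<^sup>2 in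
      N * a1 = E * (x\<^sup>2 + y\<^sup>2 - z\<^sup>2 - t\<^sup>2) \<and> N * a2 = E * (2*(y*z + x*t)) \<and> N * a3 = E * (2*(y*t - x*z)) \<and>
      N * b1 = E * (2*(y*z - x*t)) \<and> N * b2 = E * (x\<^sup>2 - y\<^sup>2 + z\<^sup>2 - t\<^sup>2) \<and> N * b3 = E * (2*(z*t + x*y)) \<and>
      N * c1 = E * (2*(y*t + x*z)) \<and> N * c2 = E * (2*(z*t - x*y)) \<and> N * c3 = E * (x\<^sup>2 - y\<^sup>2 - z\<^sup>2 + t\<^sup>2))"

text \<open>For the matrix of \<open>v \<mapsto> q v q*\<close> with a real quaternion \<open>q\<close> of norm \<open>E\<close>, the products \<open>4 q\<^sub>i q\<^sub>j\<close> are linear in the matrix entries: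
  the squares come from the diagonal, the mixed products from off-diagonal sums and differences. The
  vector below is the row \<open>4 q\<^sub>0 q\<close> of this rank one matrix, hence a multiple of \<open>q\<close>. It can
  vanish: for half turns \<open>q\<^sub>0 = 0\<close>.\<close>

lemma quaternion_represents_first_row:
  assumes M: "scaled_rotation E a1 a2 a3 b1 b2 b3 c1 c2 c3" and E: "E \<noteq> 0"
  shows "quaternion_represents (E + a1 + b2 + c3) (b3 - c2) (c1 - a3) (a2 - b1) E a1 a2 a3 b1 b2 b3 c1 c2 c3"
proof -
  define x y z t where r: "x = E + a1 + b2 + c3" "y = b3 - c2" "z = c1 - a3" "t = a2 - b1"
  note M = M[unfolded scaled_rotation_def] scaled_rotation_orthogonal[OF M E]
  have "x\<^sup>2 + y\<^sup>2 + z\<^sup>2 + t\<^sup>2 = E * (4*x)"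
    "x\<^sup>2 + y\<^sup>2 - z\<^sup>2 - t\<^sup>2 = 4*x*a1" "2*(y*z + x*t) = 4*x*a2" "2*(y*t - x*z) = 4*x*a3"
    "2*(y*z - x*t) = 4*x*b1" "x\<^sup>2 - y\<^sup>2 + z\<^sup>2 - t\<^sup>2 = 4*x*b2" "2*(z*t + x*y) = 4*x*b3"
    "2*(y*t + x*z) = 4*x*c1" "2*(z*t - x*y) = 4*x*c2" "x\<^sup>2 - y\<^sup>2 - z\<^sup>2 + t\<^sup>2 = 4*x*c3"
    using M unfolding r by (simp_all add: algebra_simps power2_eq_square)
  then have "quaternion_represents x y z t E a1 a2 a3 b1 b2 b3 c1 c2 c3"
    by (simp add: quaternion_represents_def)
  then show ?thesis
    unfolding r .
qed

text \<open>The four diagonal entries of the rank one matrix sum to \<open>4E\<close>, so some row is nonzero. The other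
  three rows reduce to the first one: changing the sign of two columns composes the rotation with
  a half turn about a coordinate axis, which multiplies the quaternion by \<open>i\<close>, \<open>j\<close> or \<open>k\<close> on the right.\<close>

lemma rotation_by_integer_quaternion:
  assumes M: "scaled_rotation E a1 a2 a3 b1 b2 b3 c1 c2 c3" and E: "E \<noteq> 0"
  obtains x y z t where "quaternion_represents x y z t E a1 a2 a3 b1 b2 b3 c1 c2 c3" "x \<noteq> 0 \<or> y \<noteq> 0 \<or> z \<noteq> 0 \<or> t \<noteq> 0"
proof -
  have "E + a1 + b2 + c3 \<noteq> 0 \<or> E + a1 - b2 - c3 \<noteq> 0 \<or> E - a1 + b2 - c3 \<noteq> 0 \<or> E - a1 - b2 + c3 \<noteq> 0"
    using E by linarith
  then consider "E + a1 + b2 + c3 \<noteq> 0" | "E + a1 - b2 - c3 \<noteq> 0"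
    | "E - a1 + b2 - c3 \<noteq> 0" | "E - a1 - b2 + c3 \<noteq> 0"
    by blast
  then show ?thesis
  proof cases
    case 1
    with quaternion_represents_first_row[OF M E] that show ?thesis by blast
  next
    case 2
    have "scaled_rotation E a1 a2 a3 (-b1) (-b2) (-b3) (-c1) (-c2) (-c3)"
      using M unfolding scaled_rotation_def by simp
    from quaternion_represents_first_row[OF this E]
    have "quaternion_represents (b3 - c2) (E + a1 - b2 - c3) (a2 + b1) (a3 + c1) E a1 a2 a3 b1 b2 b3 c1 c2 c3"
      unfolding quaternion_represents_def Let_def by (simp add: algebra_simps power2_eq_square)
    with that 2 show ?thesis by blast
  next
    case 3
    have "scaled_rotation E (-a1) (-a2) (-a3) b1 b2 b3 (-c1) (-c2) (-c3)"
      using M unfolding scaled_rotation_def by simp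
    from quaternion_represents_first_row[OF this E]
    have "quaternion_represents (c1 - a3) (a2 + b1) (E - a1 + b2 - c3) (b3 + c2) E a1 a2 a3 b1 b2 b3 c1 c2 c3"
      unfolding quaternion_represents_def Let_def by (simp add: algebra_simps power2_eq_square)
    with that 3 show ?thesis by blast
  next
    case 4
    have "scaled_rotation E (-a1) (-a2) (-a3) (-b1) (-b2) (-b3) c1 c2 c3"
      using M unfolding scaled_rotation_def by simp
    from quaternion_represents_first_row[OF this E]
    have "quaternion_represents (a2 - b1) (c1 + a3) (b3 + c2) (E - a1 - b2 + c3) E a1 a2 a3 b1 b2 b3 c1 c2 c3"
      unfolding quaternion_represents_def Let_def by (simp add: algebra_simps power2_eq_square)
    with that 4 show ?thesis by blast
  qed
qed

text \<open>Both sides of the representing equations are homogeneous of degree two in the quaternion, so a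
  common factor of its coordinates can be cancelled.\<close>

lemma quaternion_represents_primitive:
  assumes "quaternion_represents x y z t E a1 a2 a3 b1 b2 b3 c1 c2 c3" "x \<noteq> 0 \<or> y \<noteq> 0 \<or> z \<noteq> 0 \<or> t \<noteq> 0"
  obtains x' y' z' t' where "quaternion_represents x' y' z' t' E a1 a2 a3 b1 b2 b3 c1 c2 c3"
    "gcd (gcd x' y') (gcd z' t') = 1"
proof -
  define g where "g = gcd (gcd x y) (gcd z t)"
  have g: "g \<noteq> 0" "g \<ge> 0"
    using assms(2) by (auto simp: g_def)
  have "g dvd x" "g dvd y" "g dvd z" "g dvd t"
    by (auto simp: g_def intro: dvd_trans gcd_dvd1 gcd_dvd2)
  then obtain x' y' z' t' where r: "x = g * x'" "y = g * y'" "z = g * z'" "t = g * t'"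
    by (auto elim!: dvdE)
  have "g = g * gcd (gcd x' y') (gcd z' t')"
    using g by (subst (1) g_def) (simp add: r gcd_mult_left abs_mult)
  then have 1: "gcd (gcd x' y') (gcd z' t') = 1"
    using g by simp
  have hom: "(g\<^sup>2 * N) * m = E * (g\<^sup>2 * R) \<longleftrightarrow> N * m = E * R" for N m R
    using g by (auto simp: mult.assoc mult.left_commute[of E])
  have pull: "(g*p)\<^sup>2 = g\<^sup>2 * p\<^sup>2" "(g*p)*(g*q) = g\<^sup>2 * (p*q)" "2 * (g\<^sup>2 * p) = g\<^sup>2 * (2 * p)" for p q
    by (simp_all add: power2_eq_square)
  have "quaternion_represents x' y' z' t' E a1 a2 a3 b1 b2 b3 c1 c2 c3"
    using assms(1) unfolding quaternion_represents_def Let_def r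
    by (simp only: pull distrib_left[symmetric] right_diff_distrib[symmetric] hom)
  from that[OF this 1] show ?thesis .
qed

section \<open>Lattice frames and the scale of the quaternion\<close>

text \<open>In terms of \<open>\<zeta>\<^sub>0, \<eta>\<^sub>0, n\<^sub>0\<close> the unit vectors are given by \<open>3e\<^sub>1 = \<zeta>\<^sub>0 + \<eta>\<^sub>0 - n\<^sub>0\<close>,
  \<open>3e\<^sub>2 = 3e\<^sub>1 - 3\<zeta>\<^sub>0\<close> and \<open>3e\<^sub>3 = 3\<eta>\<^sub>0 - 3e\<^sub>1\<close>. Replacing \<open>\<zeta>\<^sub>0, \<eta>\<^sub>0, n\<^sub>0\<close> by \<open>a, b, c\<close> gives the
  columns of three times the matrix that takes the first frame to the second.\<close>

lemma frame_scaled_rotation: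
  fixes a1 a2 a3 b1 b2 b3 c1 c2 c3 D :: int
  assumes a: "a1\<^sup>2 + a2\<^sup>2 + a3\<^sup>2 = 2*D\<^sup>2" and b: "b1\<^sup>2 + b2\<^sup>2 + b3\<^sup>2 = 2*D\<^sup>2"
    and ab: "a1*b1 + a2*b2 + a3*b3 = D\<^sup>2"
    and c: "a2*b3 - a3*b2 = D*c1" "a3*b1 - a1*b3 = D*c2" "a1*b2 - a2*b1 = D*c3"
    and D: "D \<noteq> 0"
  defines "u1 \<equiv> a1 + b1 - c1" and "u2 \<equiv> a2 + b2 - c2" and "u3 \<equiv> a3 + b3 - c3"
  shows "scaled_rotation (3*D) u1 u2 u3 (u1 - 3*a1) (u2 - 3*a2) (u3 - 3*a3) (3*b1 - u1) (3*b2 - u2) (3*b3 - u3)"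
proof -
  have cancel: "p = q" if "D * p = D * q" for p q :: int
    using that D by simp
  have bc: "b2*c3 - b3*c2 = D*(2*a1 - b1)" "b3*c1 - b1*c3 = D*(2*a2 - b2)" "b1*c2 - b2*c1 = D*(2*a3 - b3)"
    by (rule cancel, insert b ab c, algebra)+
  have ca: "c2*a3 - c3*a2 = D*(2*b1 - a1)" "c3*a1 - c1*a3 = D*(2*b2 - a2)" "c1*a2 - c2*a1 = D*(2*b3 - a3)"
    by (rule cancel, insert a ab c, algebra)+
  have ac: "a1*c1 + a2*c2 + a3*c3 = 0" "b1*c1 + b2*c2 + b3*c3 = 0"
    by (rule cancel, insert c, algebra)+
  have cc: "c1\<^sup>2 + c2\<^sup>2 + c3\<^sup>2 = 3*D\<^sup>2"
    by (rule cancel, rule cancel, insert a b ab c, algebra)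
  show ?thesis
    unfolding scaled_rotation_def u1_def u2_def u3_def
    using a b ab c bc ca ac cc by (simp add: algebra_simps power2_eq_square)
qed

text \<open>The two primitivity conditions bound the scale \<open>s\<close> from both sides. Comparing the normals, the norm
  \<open>N\<close> times \<open>c\<close> is divisible by \<open>D\<close>, and \<open>c\<close> is primitive, so \<open>s = N/D\<close> is an integer. Comparing the
  matrices, \<open>12 r\<^sub>i\<^sup>2\<close> is \<open>s\<close> times an integer for each coordinate \<open>r\<^sub>i\<close> of the quaternion, and these
  coordinates have no common factor, so \<open>s\<close> divides 12.\<close>

lemma triangle_multiple_PQ:
  fixes a1 a2 a3 b1 b2 b3 c1 c2 c3 D :: int
  assumes a: "a1\<^sup>2 + a2\<^sup>2 + a3\<^sup>2 = 2*D\<^sup>2" and b: "b1\<^sup>2 + b2\<^sup>2 + b3\<^sup>2 = 2*D\<^sup>2"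
    and ab: "a1*b1 + a2*b2 + a3*b3 = D\<^sup>2"
    and c: "a2*b3 - a3*b2 = D*c1" "a3*b1 - a1*b3 = D*c2" "a1*b2 - a2*b1 = D*c3"
    and c_primitive: "gcd c1 (gcd c2 c3) = 1"
    and D: "D > 0"
  obtains x y z t s where "s dvd 12" "s > 0" "x\<^sup>2 + y\<^sup>2 + z\<^sup>2 + t\<^sup>2 = s * D"
    "vertex_P x y z t = of_int s *\<^sub>R vector [of_int a1, of_int a2, of_int a3]"
    "vertex_Q x y z t = of_int s *\<^sub>R vector [of_int b1, of_int b2, of_int b3]"
proof -
  have D0: "D \<noteq> 0" "3*D \<noteq> 0" using D by auto
  define u1 u2 u3 where u: "u1 = a1 + b1 - c1" "u2 = a2 + b2 - c2" "u3 = a3 + b3 - c3"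
  have "scaled_rotation (3*D) u1 u2 u3 (u1 - 3*a1) (u2 - 3*a2) (u3 - 3*a3) (3*b1 - u1) (3*b2 - u2) (3*b3 - u3)"
    unfolding u using frame_scaled_rotation[OF a b ab c D0(1)] .
  from rotation_by_integer_quaternion[OF this D0(2)] quaternion_represents_primitive
  obtain x y z t where
    rep: "quaternion_represents x y z t (3*D) u1 u2 u3 (u1 - 3*a1) (u2 - 3*a2) (u3 - 3*a3) (3*b1 - u1) (3*b2 - u2) (3*b3 - u3)"
    and prim: "gcd (gcd x y) (gcd z t) = 1"
    by metis
  define N where "N = x\<^sup>2 + y\<^sup>2 + z\<^sup>2 + t\<^sup>2"
  note rep = rep[unfolded quaternion_represents_def Let_def, folded N_def]
  \<comment> \<open>The image of the normal \<open>(-1, -1, 1)\<close>: minus the first two columns plus the third.\<close>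
  have "N * c1 = D * (- (x\<^sup>2 + y\<^sup>2 - z\<^sup>2 - t\<^sup>2) - 2*(y*z - x*t) + 2*(y*t + x*z))"
    "N * c2 = D * (- (2*(y*z + x*t)) - (x\<^sup>2 - y\<^sup>2 + z\<^sup>2 - t\<^sup>2) + 2*(z*t - x*y))"
    "N * c3 = D * (- (2*(y*t - x*z)) - 2*(z*t + x*y) + (x\<^sup>2 - y\<^sup>2 - z\<^sup>2 + t\<^sup>2))"
    using rep unfolding u by (simp_all add: algebra_simps)
  then have "D dvd N * c1" "D dvd N * c2" "D dvd N * c3"
    by (metis dvd_triv_left)+
  then have "D dvd gcd (N * c1) (gcd (N * c2) (N * c3))"
    by simp
  also have "gcd (N * c1) (gcd (N * c2) (N * c3)) = N"
    using c_primitive by (simp add: gcd_mult_left N_def)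
  finally obtain s where s: "N = D * s" ..
  have "N > 0"
    using prim by (auto simp: N_def add_nonneg_eq_0_iff less_le)
  with s D have "s > 0"
    by (simp add: zero_less_mult_iff)
  have cancel: "p = q" if "D * p = D * q" for p q :: int
    using that D by simp
  have R: "s * u1 = 3 * (x\<^sup>2 + y\<^sup>2 - z\<^sup>2 - t\<^sup>2)" "s * (u2 - 3*a2) = 3 * (x\<^sup>2 - y\<^sup>2 + z\<^sup>2 - t\<^sup>2)"
    "s * (3*b3 - u3) = 3 * (x\<^sup>2 - y\<^sup>2 - z\<^sup>2 + t\<^sup>2)"
    by (rule cancel, insert rep s, simp add: algebra_simps)+
  \<comment> \<open>The sums of the norm and the signed diagonal entries single out the squares of the coordinates.\<close>
  have "12 * x\<^sup>2 = s * (3*D + u1 + (u2 - 3*a2) + (3*b3 - u3))"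
    "12 * y\<^sup>2 = s * (3*D + u1 - (u2 - 3*a2) - (3*b3 - u3))"
    "12 * z\<^sup>2 = s * (3*D - u1 + (u2 - 3*a2) - (3*b3 - u3))"
    "12 * t\<^sup>2 = s * (3*D - u1 - (u2 - 3*a2) + (3*b3 - u3))"
    using R s unfolding N_def by (simp_all add: algebra_simps)
  then have "s dvd gcd (gcd (12 * x\<^sup>2) (12 * y\<^sup>2)) (gcd (12 * z\<^sup>2) (12 * t\<^sup>2))"
    by (metis dvd_triv_left gcd_greatest)
  also have "\<dots> = 12 * (gcd (gcd x y) (gcd z t))\<^sup>2"
    by (simp add: gcd_mult_left)
  finally have "s dvd 12"
    using prim by simp
  have P: "x\<^sup>2 + y\<^sup>2 - z\<^sup>2 - t\<^sup>2 + 2 * (x*t - y*z) = s * a1"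
      "- (x\<^sup>2) + y\<^sup>2 - z\<^sup>2 + t\<^sup>2 + 2 * (y*z + x*t) = s * a2"
      "2 * (y*t - z*t - x*y - x*z) = s * a3"
    and Q: "x\<^sup>2 + y\<^sup>2 - z\<^sup>2 - t\<^sup>2 + 2 * (y*t + x*z) = s * b1"
      "2 * (y*z + z*t + x*t - x*y) = s * b2"
      "x\<^sup>2 - y\<^sup>2 - z\<^sup>2 + t\<^sup>2 + 2 * (y*t - x*z) = s * b3"
    by (rule cancel, insert rep s, simp add: algebra_simps)+
  have "vertex_P x y z t = of_int s *\<^sub>R vector [of_int a1, of_int a2, of_int a3]"
    "vertex_Q x y z t = of_int s *\<^sub>R vector [of_int b1, of_int b2, of_int b3]"
    unfolding vertex_P_def vertex_Q_def P Q by (simp_all add: vec_eq_iff forall_3)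
  with that \<open>s dvd 12\<close> \<open>s > 0\<close> s show ?thesis
    unfolding N_def by (metis mult.commute)
qed

section \<open>Multiplying the quaternion by symmetries of the triangle\<close>

lemma vertex_scale:
  "vertex_P (k*x) (k*y) (k*z) (k*t) = of_int (k\<^sup>2) *\<^sub>R vertex_P x y z t"
  "vertex_Q (k*x) (k*y) (k*z) (k*t) = of_int (k\<^sup>2) *\<^sub>R vertex_Q x y z t"
  by (simp_all add: vec_eq_iff forall_3 vertex_P_def vertex_Q_def algebra_simps power2_eq_square)

text \<open>The coordinates on the left are those of \<open>r u\<close> for a quaternion \<open>u\<close>, and \<open>P(r u)\<close>, \<open>Q(r u)\<close> are the
  images under \<open>r\<close> of \<open>u \<zeta>\<^sub>0 u*\<close>, \<open>u \<eta>\<^sub>0 u*\<close>. For \<open>u = n\<^sub>0 = -i - j + k\<close> this is a half turn in the plane of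
  the triangle, scaled by the norm 3.\<close>

lemma vertex_mult_normal:
  "vertex_P (y+z-t) (-x+z+t) (-x-y-t) (x-y+z) = - 3 *\<^sub>R vertex_P x y z t"
  "vertex_Q (y+z-t) (-x+z+t) (-x-y-t) (x-y+z) = - 3 *\<^sub>R vertex_Q x y z t"
  by (simp_all add: vec_eq_iff forall_3 vertex_P_def vertex_Q_def algebra_simps power2_eq_square)

text \<open>The factors \<open>1 \<plusminus> n\<^sub>0\<close> of norm 4 turn the plane of the triangle by a third of a full turn.\<close>

lemma vertex_mult_one_plus_normal:
  "vertex_P (x+y+z-t) (-x+y+z+t) (-x-y+z-t) (x-y+z+t) = 4 *\<^sub>R (vertex_Q x y z t - vertex_P x y z t)"
  "vertex_Q (x+y+z-t) (-x+y+z+t) (-x-y+z-t) (x-y+z+t) = - 4 *\<^sub>R vertex_P x y z t"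
  by (simp_all add: vec_eq_iff forall_3 vertex_P_def vertex_Q_def algebra_simps power2_eq_square)

lemma vertex_mult_one_minus_normal:
  "vertex_P (x-y-z+t) (x+y-z-t) (x+y+z+t) (-x+y-z+t) = -4 *\<^sub>R vertex_Q x y z t"
  "vertex_Q (x-y-z+t) (x+y-z-t) (x+y+z+t) (-x+y-z+t) = 4 *\<^sub>R (vertex_P x y z t - vertex_Q x y z t)"
  by (simp_all add: vec_eq_iff forall_3 vertex_P_def vertex_Q_def algebra_simps power2_eq_square)

text \<open>The factors \<open>j + k\<close>, \<open>i + k\<close> and \<open>i - j\<close> are up to sign the side vectors \<open>\<zeta>\<^sub>0 - \<eta>\<^sub>0\<close>, \<open>\<eta>\<^sub>0\<close> and \<open>\<zeta>\<^sub>0\<close>. A half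
  turn about a side vector reflects the hexagon and reverses the orientation of the triangle.\<close>

lemma vertex_mult_j_plus_k:
  "vertex_P (-z-t) (z-t) (x-y) (x+y) = -2 *\<^sub>R vertex_Q x y z t"
  "vertex_Q (-z-t) (z-t) (x-y) (x+y) = -2 *\<^sub>R vertex_P x y z t"
  by (simp_all add: vec_eq_iff forall_3 vertex_P_def vertex_Q_def algebra_simps power2_eq_square)

lemma vertex_mult_i_plus_k:
  "vertex_P (-y-t) (x+z) (t-y) (x-z) = 2 *\<^sub>R (vertex_Q x y z t - vertex_P x y z t)"
  "vertex_Q (-y-t) (x+z) (t-y) (x-z) = 2 *\<^sub>R vertex_Q x y z t"
  by (simp_all add: vec_eq_iff forall_3 vertex_P_def vertex_Q_def algebra_simps power2_eq_square)

lemma vertex_mult_i_minus_j: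
  "vertex_P (z-y) (x+t) (t-x) (-z-y) = 2 *\<^sub>R vertex_P x y z t"
  "vertex_Q (z-y) (x+t) (t-x) (-z-y) = 2 *\<^sub>R (vertex_P x y z t - vertex_Q x y z t)"
  by (simp_all add: vec_eq_iff forall_3 vertex_P_def vertex_Q_def algebra_simps power2_eq_square)

section \<open>Removing the scale\<close>

text \<open>Basic rotations of the triangle \<open>O, u, v\<close> replace \<open>u, v\<close> by two neighbours in the hexagon
  \<open>u, v, v - u, -u, -v, u - v\<close>.\<close>

lemma basic_rotation_hexagon:
  "basic_rotation {0, u, v} {0, u, v}" "basic_rotation {0, u, v} {0, u - v, u}"
  "basic_rotation {0, u, v} {0, - v, u - v}" "basic_rotation {0, u, v} {0, - u, - v}"
  "basic_rotation {0, u, v} {0, v - u, - u}" "basic_rotation {0, u, v} {0, v, v - u}"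
proof -
  have rot: "basic_rotation {0, u, v}
      {0, of_int m *\<^sub>R u - of_int n *\<^sub>R v, of_int n *\<^sub>R u + of_int (m - n) *\<^sub>R v}"
    if "(m, n) \<in> {(1, 0), (1, 1), (0, 1), (-1, 0), (-1, -1), (0, -1)}" for m n :: int
    using that unfolding basic_rotation_def by blast
  show "basic_rotation {0, u, v} {0, u, v}" "basic_rotation {0, u, v} {0, u - v, u}"
    "basic_rotation {0, u, v} {0, - v, u - v}" "basic_rotation {0, u, v} {0, - u, - v}"
    "basic_rotation {0, u, v} {0, v - u, - u}" "basic_rotation {0, u, v} {0, v, v - u}"
    using rot[of 1 0] rot[of 1 1] rot[of 0 1] rot[of "-1" 0] rot[of "-1" "-1"] rot[of 0 "-1"]
    by simp_all
qed

lemma basic_rotation_uminus: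
  assumes "basic_rotation T {0, - u, - v}"
  shows "basic_rotation T {0, u, v}"
proof -
  have image: "{0, u, v} = uminus ` {0, -u, -v}" by simp
  from assms obtain a b m n where mn: "(m, n) \<in> {(1, 0), (1, 1), (0, 1), (-1, 0), (-1, -1), (0, -1)}"
    and T: "T = {0, a, b}"
    and e: "{0, - u, - v} = {0, of_int m *\<^sub>R a - of_int n *\<^sub>R b, of_int n *\<^sub>R a + of_int (m - n) *\<^sub>R b}"
    unfolding basic_rotation_def by blast
  have "{0, u, v} = {0, of_int (-m) *\<^sub>R a - of_int (-n) *\<^sub>R b, of_int (-n) *\<^sub>R a + of_int (-m - -n) *\<^sub>R b}"
    unfolding image e by (simp add: algebra_simps)
  moreover have "(-m, -n) \<in> {(1, 0), (1, 1), (0, 1), (-1, 0), (-1, -1), (0, -1)}"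
    using mn by auto
  ultimately show ?thesis
    unfolding basic_rotation_def T by blast
qed

text \<open>For even norm the coordinates of \<open>r\<close> can be paired with equal parities inside each pair. Each of the
  three pairings makes \<open>r u\<close> divisible by 2 for one of the side vectors \<open>u\<close>, and half of \<open>r u\<close> has
  the original triangle as its image.\<close>

lemma remove_factor_two:
  assumes P: "vertex_P x y z t = 2 *\<^sub>R \<zeta>" and Q: "vertex_Q x y z t = 2 *\<^sub>R \<eta>"
    and even: "even (x\<^sup>2 + y\<^sup>2 + z\<^sup>2 + t\<^sup>2)"
  shows "\<exists>x y z t. basic_rotation {0, vertex_P x y z t, vertex_Q x y z t} {0, \<zeta>, \<eta>}"
proof -
  consider "even (x - y)" "even (z - t)" | "even (x - z)" "even (y - t)" | "even (x - t)" "even (y - z)"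
    using even by fastforce
  then show ?thesis
  proof cases
    case 1
    then obtain p q r w where k: "-z-t = 2*p" "z-t = 2*q" "x-y = 2*r" "x+y = 2*w"
      by (metis even_add even_diff even_minus diff_conv_add_uminus dvdE)
    have "vertex_P p q r w = - \<eta>" "vertex_Q p q r w = - \<zeta>"
      using vertex_mult_j_plus_k[of z t x y, unfolded k vertex_scale] P Q
      by (simp_all add: scaleR_minus_right[symmetric] del: scaleR_minus_right)
    then have "basic_rotation {0, vertex_P p q r w, vertex_Q p q r w} {0, \<eta>, \<zeta>}"
      using basic_rotation_hexagon(4)[of "- \<eta>" "- \<zeta>"] by simp
    then show ?thesis by (auto simp: insert_commute)
  next
    case 2
    then obtain p q r w where k: "-y-t = 2*p" "x+z = 2*q" "t-y = 2*r" "x-z = 2*w"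
      by (metis even_add even_diff even_minus diff_conv_add_uminus dvdE)
    have "vertex_P p q r w = \<eta> - \<zeta>" "vertex_Q p q r w = \<eta>"
      using vertex_mult_i_plus_k[of y t x z, unfolded k vertex_scale] P Q by (simp_all add: scaleR_diff_right[symmetric])
    then have "basic_rotation {0, vertex_P p q r w, vertex_Q p q r w} {0, \<eta>, \<zeta>}"
      using basic_rotation_hexagon(6)[of "\<eta> - \<zeta>" \<eta>] by simp
    then show ?thesis by (auto simp: insert_commute)
  next
    case 3
    then obtain p q r w where k: "z-y = 2*p" "x+t = 2*q" "t-x = 2*r" "-z-y = 2*w"
      by (metis even_add even_diff even_minus diff_conv_add_uminus dvdE)
    have "vertex_P p q r w = \<zeta>" "vertex_Q p q r w = \<zeta> - \<eta>"
      using vertex_mult_i_minus_j[of z y x t, unfolded k vertex_scale] P Q by (simp_all add: scaleR_diff_right[symmetric])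
    then have "basic_rotation {0, vertex_P p q r w, vertex_Q p q r w} {0, \<eta>, \<zeta>}"
      using basic_rotation_hexagon(2)[of \<zeta> "\<zeta> - \<eta>"] by simp
    then show ?thesis by (auto simp: insert_commute)
  qed
qed

lemma four_dvd_sum_four_squares:
  fixes x y z t :: int
  assumes "4 dvd x\<^sup>2 + y\<^sup>2 + z\<^sup>2 + t\<^sup>2"
  shows "even x \<and> even y \<and> even z \<and> even t \<or> odd x \<and> odd y \<and> odd z \<and> odd t"
proof -
  have sq: "w\<^sup>2 mod 4 = (if even w then 0 else 1)" for w :: int
  proof (cases "even w")
    case True
    then show ?thesis by (auto elim!: evenE simp: power2_eq_square)
  next
    case False
    then obtain b where "w = 2*b + 1" by (auto elim!: oddE)
    then have "w\<^sup>2 = 1 + (b\<^sup>2 + b) * 4" by (simp add: algebra_simps power2_eq_square)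
    then have "w\<^sup>2 mod 4 = 1" by (simp only: mod_mult_self1) simp
    with False show ?thesis by simp
  qed
  have "(x\<^sup>2 mod 4 + y\<^sup>2 mod 4 + z\<^sup>2 mod 4 + t\<^sup>2 mod 4) mod 4 = 0"
    using assms by presburger
  then show ?thesis
    unfolding sq by (auto split: if_splits)
qed

text \<open>If all coordinates are even, half of \<open>r\<close> works. If all are odd, then \<open>r(1 + n\<^sub>0)\<close> and \<open>r(1 - n\<^sub>0)\<close>
  have even coordinates that are congruent modulo 4 within each of the two quaternions, and their sum
  is \<open>2r\<close>; so exactly one of the two is divisible by 4.\<close>

lemma remove_factor_four:
  assumes P: "vertex_P x y z t = 4 *\<^sub>R \<zeta>" and Q: "vertex_Q x y z t = 4 *\<^sub>R \<eta>"
    and four: "4 dvd x\<^sup>2 + y\<^sup>2 + z\<^sup>2 + t\<^sup>2"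
  shows "\<exists>x y z t. basic_rotation {0, vertex_P x y z t, vertex_Q x y z t} {0, \<zeta>, \<eta>}"
proof -
  have odd: "4 dvd x+y+z-t \<and> 4 dvd -x+y+z+t \<and> 4 dvd -x-y+z-t \<and> 4 dvd x-y+z+t \<or>
      4 dvd x-y-z+t \<and> 4 dvd x+y-z-t \<and> 4 dvd x+y+z+t \<and> 4 dvd -x+y-z+t"
    if "odd x" "odd y" "odd z" "odd t"
  proof -
    from that obtain a b c d where "x = 2*a+1" "y = 2*b+1" "z = 2*c+1" "t = 2*d+1"
      by (auto elim!: oddE)
    \<comment> \<open>The parity of \<open>a + b + c + d\<close> decides which alternative holds.\<close>
    then show ?thesis by presburger
  qed
  consider
      (halve) "2 dvd x" "2 dvd y" "2 dvd z" "2 dvd t"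
    | (plus) "4 dvd x+y+z-t" "4 dvd -x+y+z+t" "4 dvd -x-y+z-t" "4 dvd x-y+z+t"
    | (minus) "4 dvd x-y-z+t" "4 dvd x+y-z-t" "4 dvd x+y+z+t" "4 dvd -x+y-z+t"
    using four_dvd_sum_four_squares[OF four] odd by blast
  then show ?thesis
  proof cases
    case halve
    then obtain p q r w where k: "x = 2*p" "y = 2*q" "z = 2*r" "t = 2*w"
      by (auto elim!: dvdE)
    have "vertex_P p q r w = \<zeta>" "vertex_Q p q r w = \<eta>"
      using P Q unfolding k vertex_scale by simp_all
    then show ?thesis
      using basic_rotation_hexagon(1) by metis
  next
    case plus
    then obtain p q r w where k: "x+y+z-t = 4*p" "-x+y+z+t = 4*q" "-x-y+z-t = 4*r" "x-y+z+t = 4*w"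
      by (auto elim!: dvdE)
    have "vertex_P p q r w = \<eta> - \<zeta>" "vertex_Q p q r w = - \<zeta>"
      using vertex_mult_one_plus_normal[of x y z t, unfolded k vertex_scale] P Q
      by (simp_all add: scaleR_minus_right[symmetric] scaleR_diff_right[symmetric] del: scaleR_minus_right)
    then have "basic_rotation {0, vertex_P p q r w, vertex_Q p q r w} {0, \<zeta>, \<eta>}"
      using basic_rotation_hexagon(3)[of "\<eta> - \<zeta>" "-\<zeta>"] by simp
    then show ?thesis by blast
  next
    case minus
    then obtain p q r w where k: "x-y-z+t = 4*p" "x+y-z-t = 4*q" "x+y+z+t = 4*r" "-x+y-z+t = 4*w"
      by (auto elim!: dvdE)
    have "vertex_P p q r w = - \<eta>" "vertex_Q p q r w = \<zeta> - \<eta>"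
      using vertex_mult_one_minus_normal[of x y z t, unfolded k vertex_scale] P Q
      by (simp_all add: scaleR_minus_right[symmetric] scaleR_diff_right[symmetric] del: scaleR_minus_right)
    then have "basic_rotation {0, vertex_P p q r w, vertex_Q p q r w} {0, \<zeta>, \<eta>}"
      using basic_rotation_hexagon(5)[of "-\<eta>" "\<zeta>-\<eta>"] by simp
    then show ?thesis by blast
  qed
qed

text \<open>Each coordinate of \<open>r n\<^sub>0\<close> has a square that is modulo 3 a combination of the coordinates of \<open>P(r)\<close> and
  \<open>Q(r)\<close>: as \<open>n\<^sub>0\<close> is nilpotent modulo 3, divisibility of \<open>P(r)\<close> and \<open>Q(r)\<close> by 3 forces \<open>r n\<^sub>0\<close> to vanish
  modulo 3. A third of \<open>r n\<^sub>0\<close> then gives the triangle with the factor 3 removed and turned by a half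
  turn.\<close>

lemma remove_factor_three:
  assumes P: "vertex_P x y z t = of_int (3 * k) *\<^sub>R \<zeta>" and Q: "vertex_Q x y z t = of_int (3 * k) *\<^sub>R \<eta>"
    and lat: "\<zeta> \<in> int_lattice" "\<eta> \<in> int_lattice"
  obtains x' y' z' t' where "vertex_P x' y' z' t' = of_int k *\<^sub>R (- \<zeta>)" "vertex_Q x' y' z' t' = of_int k *\<^sub>R (- \<eta>)"
    "3 * (x'\<^sup>2 + y'\<^sup>2 + z'\<^sup>2 + t'\<^sup>2) = x\<^sup>2 + y\<^sup>2 + z\<^sup>2 + t\<^sup>2"
proof -
  have lattice_dvd: "3 dvd p" if "of_int p = of_int (3 * k) * v" "v \<in> \<int>" for p k :: int and v :: real
  proof -
    from that(2) obtain w where "v = of_int w" by (auto elim: Ints_cases)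
    with that(1) have "p = 3 * (k * w)"
      by (metis of_int_eq_iff of_int_mult mult.assoc)
    then show ?thesis by simp
  qed
  have comp: "vertex_P x y z t $ i = of_int (3 * k) * \<zeta> $ i" "vertex_Q x y z t $ i = of_int (3 * k) * \<eta> $ i" for i
    using P Q by simp_all
  have "\<zeta> $ i \<in> \<int>" "\<eta> $ i \<in> \<int>" for i
    using lat by (auto simp: int_lattice_def)
  note d = lattice_dvd[OF comp(1)[unfolded vertex_P_def, of 1, unfolded vector_3] this(1)]
    lattice_dvd[OF comp(1)[unfolded vertex_P_def, of 2, unfolded vector_3] this(1)]
    lattice_dvd[OF comp(1)[unfolded vertex_P_def, of 3, unfolded vector_3] this(1)]
    lattice_dvd[OF comp(2)[unfolded vertex_Q_def, of 1, unfolded vector_3] this(2)]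
    lattice_dvd[OF comp(2)[unfolded vertex_Q_def, of 2, unfolded vector_3] this(2)]
    lattice_dvd[OF comp(2)[unfolded vertex_Q_def, of 3, unfolded vector_3] this(2)]
  from d obtain e1 e2 e3 f1 f2 f3 where e: "x\<^sup>2 + y\<^sup>2 - z\<^sup>2 - t\<^sup>2 + 2 * (x*t - y*z) = 3 * e1"
      "- (x\<^sup>2) + y\<^sup>2 - z\<^sup>2 + t\<^sup>2 + 2 * (y*z + x*t) = 3 * e2"
      "2 * (y*t - z*t - x*y - x*z) = 3 * e3"
      "x\<^sup>2 + y\<^sup>2 - z\<^sup>2 - t\<^sup>2 + 2 * (y*t + x*z) = 3 * f1"
      "2 * (y*z + z*t + x*t - x*y) = 3 * f2"
      "x\<^sup>2 - y\<^sup>2 - z\<^sup>2 + t\<^sup>2 + 2 * (y*t - x*z) = 3 * f3"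
    unfolding dvd_def by blast
  have "(y+z-t)\<^sup>2 = 3 * (e1 + e2 - e3 + f1 + f2 - f3 - (y\<^sup>2 - z\<^sup>2 - t\<^sup>2 + 2*(x*t + x*z + z*t)))"
    "(-x+z+t)\<^sup>2 = 3 * (e1 - e2 + e3 + f1 - f2 + f3 - (x\<^sup>2 - z\<^sup>2 - t\<^sup>2 + 2*(y*t - y*z - z*t)))"
    "(-x-y-t)\<^sup>2 = 3 * (- e1 + e2 + e3 - f1 + f2 + f3 - (t\<^sup>2 - x\<^sup>2 - y\<^sup>2 + 2*(y*z - x*y - x*z)))"
    "(x-y+z)\<^sup>2 = 3 * (- e1 - e2 - e3 - f1 - f2 - f3 - (z\<^sup>2 - x\<^sup>2 - y\<^sup>2 + 2*(x*y - x*t - y*t)))"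
    using e by (simp_all add: algebra_simps power2_eq_square)
  then have "3 dvd (y+z-t)\<^sup>2" "3 dvd (-x+z+t)\<^sup>2" "3 dvd (-x-y-t)\<^sup>2" "3 dvd (x-y+z)\<^sup>2"
    by (metis dvd_triv_left)+
  then have "3 dvd y+z-t" "3 dvd -x+z+t" "3 dvd -x-y-t" "3 dvd x-y+z"
    by (auto intro: prime_dvd_power)
  then obtain p q r w where k: "y+z-t = 3*p" "-x+z+t = 3*q" "-x-y-t = 3*r" "x-y+z = 3*w"
    by (auto elim!: dvdE)
  have "9 *\<^sub>R vertex_P p q r w = 9 *\<^sub>R (of_int k *\<^sub>R (- \<zeta>))" "9 *\<^sub>R vertex_Q p q r w = 9 *\<^sub>R (of_int k *\<^sub>R (- \<eta>))"
    using vertex_mult_normal[of y z t x, unfolded k vertex_scale] P Q by simp_all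
  then have "vertex_P p q r w = of_int k *\<^sub>R (- \<zeta>)" "vertex_Q p q r w = of_int k *\<^sub>R (- \<eta>)"
    by (simp_all only: scaleR_cancel_left) simp_all
  moreover have "(y+z-t)\<^sup>2 + (-x+z+t)\<^sup>2 + (-x-y-t)\<^sup>2 + (x-y+z)\<^sup>2 = 3 * (x\<^sup>2 + y\<^sup>2 + z\<^sup>2 + t\<^sup>2)"
    by (simp add: algebra_simps power2_eq_square)
  then have "3 * (p\<^sup>2 + q\<^sup>2 + r\<^sup>2 + w\<^sup>2) = x\<^sup>2 + y\<^sup>2 + z\<^sup>2 + t\<^sup>2"
    unfolding k power_mult_distrib by simp
  ultimately show ?thesis using that by blast
qed

lemma parametrised_triangle_of_multiple:
  assumes lat: "\<zeta> \<in> int_lattice" "\<eta> \<in> int_lattice"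
    and s: "s dvd 12" "s > 0" and N: "x\<^sup>2 + y\<^sup>2 + z\<^sup>2 + t\<^sup>2 = s * D"
    and P: "vertex_P x y z t = of_int s *\<^sub>R \<zeta>" and Q: "vertex_Q x y z t = of_int s *\<^sub>R \<eta>"
  shows "\<exists>x y z t. basic_rotation {0, vertex_P x y z t, vertex_Q x y z t} {0, \<zeta>, \<eta>}"
proof -
  have main: "\<exists>x y z t. basic_rotation {0, vertex_P x y z t, vertex_Q x y z t} {0, \<zeta>, \<eta>}"
    if k: "k \<in> {1, 2, 4}" and N: "x\<^sup>2 + y\<^sup>2 + z\<^sup>2 + t\<^sup>2 = k * D"
      and PQ: "vertex_P x y z t = of_int k *\<^sub>R \<zeta>" "vertex_Q x y z t = of_int k *\<^sub>R \<eta>" 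
    for x y z t k and \<zeta> \<eta> :: "real^3"
  proof -
    consider "k = 1" | "k = 2" | "k = 4" using k by blast
    then show ?thesis
    proof cases
      case 1
      with PQ basic_rotation_hexagon(1) show ?thesis by (metis of_int_1 scaleR_one)
    next
      case 2
      with PQ N show ?thesis by (intro remove_factor_two[of x y z t]) simp_all
    next
      case 3
      with PQ N show ?thesis by (intro remove_factor_four[of x y z t]) simp_all
    qed
  qed
  have "s \<le> 12" using s by (simp add: zdvd_imp_le)
  with s(2) have "s = 1 \<or> s = 2 \<or> s = 3 \<or> s = 4 \<or> s = 5 \<or> s = 6 \<or> s = 7 \<or> s = 8 \<or>
      s = 9 \<or> s = 10 \<or> s = 11 \<or> s = 12" by arith
  then have "s \<in> {1, 2, 4} \<or> s \<in> {3 * 1, 3 * 2, 3 * 4}" using s(1) by auto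
  then consider "s \<in> {1, 2, 4}" | k where "k \<in> {1, 2, 4}" "s = 3 * k" by blast
  then show ?thesis
  proof cases
    case 1
    then show ?thesis using main[OF _ N P Q] by blast
  next
    case 2
    from remove_factor_three[OF P[unfolded 2] Q[unfolded 2] lat] obtain x' y' z' t' where
      "vertex_P x' y' z' t' = of_int k *\<^sub>R (- \<zeta>)" "vertex_Q x' y' z' t' = of_int k *\<^sub>R (- \<eta>)"
      "3 * (x'\<^sup>2 + y'\<^sup>2 + z'\<^sup>2 + t'\<^sup>2) = x\<^sup>2 + y\<^sup>2 + z\<^sup>2 + t\<^sup>2"
      by blast
    moreover from this(3) have "x'\<^sup>2 + y'\<^sup>2 + z'\<^sup>2 + t'\<^sup>2 = k * D"
      unfolding N 2 by simp
    ultimately have "\<exists>x y z t. basic_rotation {0, vertex_P x y z t, vertex_Q x y z t} {0, - \<zeta>, - \<eta>}"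
      by (intro main[OF 2(1)])
    then show ?thesis
      using basic_rotation_uminus by blast
  qed
qed

section \<open>Minimal triangles\<close>

lemma int_lattice_cases:
  assumes "v \<in> int_lattice"
  obtains a b c where "v = vector [of_int a, of_int b, of_int c]"
proof -
  have "v $ 1 \<in> \<int>" "v $ 2 \<in> \<int>" "v $ 3 \<in> \<int>"
    using assms by (auto simp: int_lattice_def)
  then obtain a b c where "v $ 1 = of_int a" "v $ 2 = of_int b" "v $ 3 = of_int c"
    by (auto elim!: Ints_cases)
  then show ?thesis
    using that by (simp add: vec_eq_iff forall_3)
qed

text \<open>The Gram determinant gives the cross product squared length \<open>3D\<^sup>4\<close>. It is parallel to the normal
  \<open>(A, B, C)\<close> of squared length \<open>3D\<^sup>2\<close>, so equality in the Cauchy-Schwarz inequality determines it up to sign.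
  This is where the relation between the side length and the normal enters.\<close>

lemma cross_parallel_normal:
  fixes a1 a2 a3 b1 b2 b3 A B C D :: int
  assumes a: "a1\<^sup>2 + a2\<^sup>2 + a3\<^sup>2 = 2*D\<^sup>2" and b: "b1\<^sup>2 + b2\<^sup>2 + b3\<^sup>2 = 2*D\<^sup>2"
    and ab: "a1*b1 + a2*b2 + a3*b3 = D\<^sup>2"
    and n: "A\<^sup>2 + B\<^sup>2 + C\<^sup>2 = 3*D\<^sup>2"
    and na: "A*a1 + B*a2 + C*a3 = 0" and nb: "A*b1 + B*b2 + C*b3 = 0"
  obtains \<epsilon> :: int where "\<epsilon> = 1 \<or> \<epsilon> = -1"
    "a2*b3 - a3*b2 = D * (\<epsilon>*A)" "a3*b1 - a1*b3 = D * (\<epsilon>*B)" "a1*b2 - a2*b1 = D * (\<epsilon>*C)"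
proof -
  define c1 c2 c3 where c: "c1 = a2*b3 - a3*b2" "c2 = a3*b1 - a1*b3" "c3 = a1*b2 - a2*b1"
  have cc: "c1\<^sup>2 + c2\<^sup>2 + c3\<^sup>2 = 3 * (D\<^sup>2)\<^sup>2"
    using a b ab unfolding c by algebra
  have "B*c3 - C*c2 = 0" "C*c1 - A*c3 = 0" "A*c2 - B*c1 = 0"
    using na nb unfolding c by algebra+
  then have "(A*c1 + B*c2 + C*c3)\<^sup>2 = (A\<^sup>2 + B\<^sup>2 + C\<^sup>2) * (c1\<^sup>2 + c2\<^sup>2 + c3\<^sup>2)"
    by algebra
  also have "\<dots> = (3 * D^3)\<^sup>2"
    unfolding n cc by (simp add: power2_eq_square power3_eq_cube)
  finally obtain \<epsilon> :: int where e: "\<epsilon> = 1 \<or> \<epsilon> = -1" and nc: "A*c1 + B*c2 + C*c3 = \<epsilon> * (3 * D^3)"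
    by (metis power2_eq_iff mult_1 mult_minus1)
  have "(c1 - D * (\<epsilon>*A))\<^sup>2 + (c2 - D * (\<epsilon>*B))\<^sup>2 + (c3 - D * (\<epsilon>*C))\<^sup>2 = 0"
  proof -
    have "\<epsilon>\<^sup>2 = 1" using e by auto
    then show ?thesis using cc nc n by algebra
  qed
  then have "c1 = D * (\<epsilon>*A)" "c2 = D * (\<epsilon>*B)" "c3 = D * (\<epsilon>*C)"
    by (simp_all add: add_nonneg_eq_0_iff)
  with that e show ?thesis unfolding c by blast
qed

lemma minimal_triangle_parametrised:
  assumes "minimal_triangle T"
  shows "\<exists>x y z t. basic_rotation {0, vertex_P x y z t, vertex_Q x y z t} T"
proof -
  from assms obtain A B C D :: int where lat: "T \<subseteq> int_lattice" and "0 \<in> T"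
    and prim: "gcd A (gcd B C) = 1"
    and orth: "\<forall>v \<in> affine hull T. orthogonal (vector [of_int A, of_int B, of_int C]) v"
    and D: "D > 0" and n: "A\<^sup>2 + B\<^sup>2 + C\<^sup>2 = 3 * D\<^sup>2"
    and "equilateral_triangle (of_int D * sqrt 2) T"
    unfolding minimal_triangle_def by metis
  then obtain a b c where abc: "T = {a, b, c}" "dist a b = of_int D * sqrt 2" "dist b c = of_int D * sqrt 2"
    "dist c a = of_int D * sqrt 2"
    unfolding equilateral_triangle_def by blast
  obtain \<zeta> \<eta> where T: "T = {0, \<zeta>, \<eta>}"
    and d: "dist 0 \<zeta> = of_int D * sqrt 2" "dist 0 \<eta> = of_int D * sqrt 2" "dist \<zeta> \<eta> = of_int D * sqrt 2"
  proof -
    consider "a = 0" | "b = 0" | "c = 0"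
      using \<open>0 \<in> T\<close> abc(1) by auto
    then show ?thesis
    proof cases
      case 1
      with abc show ?thesis by (intro that[of b c]) (auto simp: dist_commute)
    next
      case 2
      with abc show ?thesis by (intro that[of c a]) (auto simp: dist_commute)
    next
      case 3
      with abc show ?thesis by (intro that[of a b]) (auto simp: dist_commute)
    qed
  qed
  have in_lat: "\<zeta> \<in> int_lattice" "\<eta> \<in> int_lattice"
    using lat T by auto
  then obtain a1 a2 a3 b1 b2 b3 where
    \<zeta>: "\<zeta> = vector [of_int a1, of_int a2, of_int a3]" and \<eta>: "\<eta> = vector [of_int b1, of_int b2, of_int b3]"
    by (metis int_lattice_cases)
  have "(dist 0 \<zeta>)\<^sup>2 = of_int (2 * D\<^sup>2)" "(dist 0 \<eta>)\<^sup>2 = of_int (2 * D\<^sup>2)" "(dist \<zeta> \<eta>)\<^sup>2 = of_int (2 * D\<^sup>2)"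
    unfolding d by (simp_all add: power_mult_distrib)
  then have "of_int (a1\<^sup>2 + a2\<^sup>2 + a3\<^sup>2) = (of_int (2 * D\<^sup>2) :: real)"
    "of_int (b1\<^sup>2 + b2\<^sup>2 + b3\<^sup>2) = (of_int (2 * D\<^sup>2) :: real)"
    "of_int ((a1 - b1)\<^sup>2 + (a2 - b2)\<^sup>2 + (a3 - b3)\<^sup>2) = (of_int (2 * D\<^sup>2) :: real)"
    unfolding dist_norm power2_norm_eq_inner inner_vec_def sum_3 \<zeta> \<eta>
    by (simp_all add: power2_eq_square)
  then have a: "a1\<^sup>2 + a2\<^sup>2 + a3\<^sup>2 = 2 * D\<^sup>2" and b: "b1\<^sup>2 + b2\<^sup>2 + b3\<^sup>2 = 2 * D\<^sup>2"
    and "(a1 - b1)\<^sup>2 + (a2 - b2)\<^sup>2 + (a3 - b3)\<^sup>2 = 2 * D\<^sup>2"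
    by (simp_all only: of_int_eq_iff)
  then have ab: "a1*b1 + a2*b2 + a3*b3 = D\<^sup>2"
    by (simp add: algebra_simps power2_eq_square)
  have "orthogonal (vector [of_int A, of_int B, of_int C]) \<zeta>" "orthogonal (vector [of_int A, of_int B, of_int C]) \<eta>"
    using orth T by (simp_all add: hull_inc)
  then have "of_int (A*a1 + B*a2 + C*a3) = (of_int 0 :: real)" "of_int (A*b1 + B*b2 + C*b3) = (of_int 0 :: real)"
    unfolding orthogonal_def inner_vec_def sum_3 \<zeta> \<eta> by simp_all
  then have "A*a1 + B*a2 + C*a3 = 0" "A*b1 + B*b2 + C*b3 = 0"
    by (simp_all only: of_int_eq_iff)
  from cross_parallel_normal[OF a b ab n this] obtain \<epsilon> :: int where e: "\<epsilon> = 1 \<or> \<epsilon> = -1"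
    and c: "a2*b3 - a3*b2 = D * (\<epsilon>*A)" "a3*b1 - a1*b3 = D * (\<epsilon>*B)" "a1*b2 - a2*b1 = D * (\<epsilon>*C)" .
  have "gcd (\<epsilon>*A) (gcd (\<epsilon>*B) (\<epsilon>*C)) = 1"
    using e prim by auto
  from triangle_multiple_PQ[OF a b ab c this D, folded \<zeta> \<eta>] obtain x y z t s where
    "s dvd 12" "s > 0" "x\<^sup>2 + y\<^sup>2 + z\<^sup>2 + t\<^sup>2 = s * D"
    "vertex_P x y z t = of_int s *\<^sub>R \<zeta>" "vertex_Q x y z t = of_int s *\<^sub>R \<eta>" .
  from parametrised_triangle_of_multiple[OF in_lat this] show ?thesis
    unfolding T .
qed

theorem corollary2p2:
  shows "(\<forall>T. minimal_triangle T \<longrightarrow>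
            (\<exists>x y z t :: int. basic_rotation {0, vertex_P x y z t, vertex_Q x y z t} T))
       \<and> (\<forall>x y z t :: int.
            {0, vertex_P x y z t, vertex_Q x y z t} \<subseteq> int_lattice \<and>
            equilateral_triangle (of_int (x\<^sup>2 + y\<^sup>2 + z\<^sup>2 + t\<^sup>2) * sqrt 2)
              {0, vertex_P x y z t, vertex_Q x y z t})"
  using minimal_triangle_parametrised vertex_PQ_lattice vertex_PQ_equilateral by blast

end
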